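(* Let $n \ge 0$ be an integer, let $x_1,\ldots,x_n > 0$, and let $\mu, a_0, b_0 > 0$. Let $f$ be the full conditional density on $(0,\infty)$ of the gamma shape parameter given $x_1,\ldots,x_n,\mu,a_0,b_0$, i.e. the probability density with $$f(a) \;\propto\; a^{a_0-1}e^{-b_0 a}\prod_{i=1}^n \frac{(a/\mu)^a}{\Gamma(a)}\,x_i^{a-1}e^{-(a/\mu)x_i}, \qquad a>0.$$ Then: (1) For any $a>0$, $\frac{\partial}{\partial a}\log f(a) + \frac{1}{a} = 0$ if and only if $a$ is a fixed point of the shape-approximation algorithm, that is, if and only if $B(a)\neq 0$ and $A(a)/B(a) = a$, where $A(\cdot)$ and $B(\cdot)$ are the algorithm's update functions (defined in the context). (2) There exists $a>0$ such that $\frac{\partial}{\partial a}\log f(a) + \frac{1}{a} = 0$.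
   Context: Model: given $a,\mu>0$, $X_1,\ldots,X_n$ are i.i.d. $\mathrm{Gamma}(\text{shape}=a,\ \text{rate}=a/\mu)$, and the prior on the shape is $a\sim\mathrm{Gamma}(\text{shape}=a_0,\ \text{rate}=b_0)$. The full conditional density is $f(a)=p(a\mid x_1,\ldots,x_n,\mu,a_0,b_0)$; for $n=0$ the product is empty and $f$ is the prior density. The normalizing constant of $f$ does not depend on $a$, so it does not affect $\frac{\partial}{\partial a}\log f(a)$. Notation: $\log$ is the natural logarithm, $\Gamma$ is the gamma function, $\psi(x)=\frac{d}{dx}\log\Gamma(x)$ is the digamma function and $\psi'(x)$ is the trigamma function. Set $$R=\sum_{i=1}^n\log(x_i),\qquad S=\sum_{i=1}^n x_i,\qquad T = S/\mu - R + n\log(\mu) - n.$$ Algorithm: it seeks a density $\mathrm{Gamma}(\text{shape}=A,\ \text{rate}=B)$ approximating $f$. Starting from initial values of $A$ and $B$, each iteration sets $a\leftarrow A/B$ and then $A\leftarrow A(a)$, $B\leftarrow B(a)$, where for $a>0$ $$A(a) = a_0 - na + na^2\psi'(a),$$ $$B(a) = b_0 + \frac{A(a)-a_0}{a} - n\log(a) + n\psi(a) + T.$$ A point $a>0$ is a fixed point of the algorithm if the next value of $a$, namely $A(a)/B(a)$, is well defined and finite (i.e. $B(a)\ne 0$) and equals $a$. *)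

theory Defs
  imports "HOL-Analysis.Analysis"
begin

text \<open>
  The observations are \<open>x 1, \<dots>, x n\<close>; values of \<open>x\<close> at other indices are irrelevant.
  The parameter \<open>m\<close> is the mean \<open>\<mu>\<close>.
\<close>

definition full_cond_kernel ::
  "nat \<Rightarrow> (nat \<Rightarrow> real) \<Rightarrow> real \<Rightarrow> real \<Rightarrow> real \<Rightarrow> real \<Rightarrow> real" where
  "full_cond_kernel n x m a0 b0 a =
     a powr (a0 - 1) * exp (- b0 * a) *
     (\<Prod>i=1..n. (a / m) powr a / Gamma a * x i powr (a - 1) * exp (- (a / m) * x i))"

definition full_cond_density ::
  "nat \<Rightarrow> (nat \<Rightarrow> real) \<Rightarrow> real \<Rightarrow> real \<Rightarrow> real \<Rightarrow> real \<Rightarrow> real" where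
  "full_cond_density n x m a0 b0 a =
     (if a > 0
      then full_cond_kernel n x m a0 b0 a /
             (LINT t:{0<..}|lborel. full_cond_kernel n x m a0 b0 t)
      else 0)"

definition stat_R :: "nat \<Rightarrow> (nat \<Rightarrow> real) \<Rightarrow> real" where
  "stat_R n x = (\<Sum>i=1..n. ln (x i))"

definition stat_S :: "nat \<Rightarrow> (nat \<Rightarrow> real) \<Rightarrow> real" where
  "stat_S n x = (\<Sum>i=1..n. x i)"

definition stat_T :: "nat \<Rightarrow> (nat \<Rightarrow> real) \<Rightarrow> real \<Rightarrow> real" where
  "stat_T n x m = stat_S n x / m - stat_R n x + real n * ln m - real n"

text \<open>\<open>Polygamma 1\<close> is the trigamma function.\<close>

definition update_A :: "nat \<Rightarrow> real \<Rightarrow> real \<Rightarrow> real" where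
  "update_A n a0 a = a0 - real n * a + real n * a\<^sup>2 * Polygamma 1 a"

definition update_B ::
  "nat \<Rightarrow> (nat \<Rightarrow> real) \<Rightarrow> real \<Rightarrow> real \<Rightarrow> real \<Rightarrow> real \<Rightarrow> real" where
  "update_B n x m a0 b0 a =
     b0 + (update_A n a0 a - a0) / a - real n * ln a + real n * Digamma a + stat_T n x m"

text \<open>
  One iteration replaces \<open>a\<close> by \<open>update_A / update_B\<close>. The condition that \<open>update_B\<close> is
  nonzero expresses that the quotient is well defined, since division is total here.
\<close>

definition algorithm_fixed_point ::
  "nat \<Rightarrow> (nat \<Rightarrow> real) \<Rightarrow> real \<Rightarrow> real \<Rightarrow> real \<Rightarrow> real \<Rightarrow> bool" where
  "algorithm_fixed_point n x m a0 b0 a \<longleftrightarrow>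
     a > 0 \<and> update_B n x m a0 b0 a \<noteq> 0 \<and>
     update_A n a0 a / update_B n x m a0 b0 a = a"

end

theory Submission
  imports Defs
begin

text \<open>
  Writing \<open>h a = a * ln a - a - ln_Gamma a\<close>, the kernel equals
  \<open>exp (- R) * a powr (a0 - 1) * exp (- (b0 + T) * a) * exp (h a) ^ n\<close>, so that
  the derivative of \<open>ln f\<close> plus \<open>1 / a\<close> is the score
  \<open>g a = a0 / a - (b0 + T) + n * (ln a - Digamma a)\<close>.
  The mean value theorem for \<open>ln_Gamma\<close> and \<open>Digamma\<close> on \<open>[a, a + 1]\<close> gives
  \<open>0 \<le> ln a - Digamma a \<le> 1 / a\<close> and \<open>Polygamma 1 a \<ge> 1 / a\<close>.
  The former bounds \<open>exp (h a)\<close> by \<open>max 1 a\<close>, so the normalising constant is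
  finite (and positive), and yields a sign change of \<open>g\<close> between \<open>a0 / (b0 + T)\<close> and
  \<open>(a0 + n) / (b0 + T)\<close>. The latter gives \<open>A a > 0\<close>; as \<open>a * B a = A a - a * g a\<close>,
  zeros of \<open>g\<close> are exactly the fixed points.
\<close>

subsection \<open>Bounds for the digamma and trigamma functions\<close>

text \<open>The increment of \<open>ln_Gamma\<close> over [x, x + 1] is \<open>ln x\<close>, so
  \<open>ln x = Digamma z\<close> for some z in between. Both bounds follow since
  \<open>Digamma\<close> is increasing and
  \<open>Digamma (x + 1) = Digamma x + 1 / x\<close>.\<close>

lemma ln_bounds_Digamma_real:
  fixes x :: real
  assumes "x > 0"
  shows "Digamma x \<le> ln x" "ln x \<le> Digamma x + 1 / x"
proof -
  have "\<exists>z. x < z \<and> z < x + 1 \<and> ln_Gamma (x + 1) - ln_Gamma x = (x + 1 - x) * Digamma z"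
    using assms by (intro MVT2 has_field_derivative_ln_Gamma_real) auto
  then obtain z where z: "x < z" "z < x + 1" "ln_Gamma (x + 1) - ln_Gamma x = Digamma z"
    by auto
  have "Gamma (x + 1) = x * Gamma x"
    using assms by (intro Gamma_plus1) (auto elim!: nonpos_Ints_cases)
  then have "ln_Gamma (x + 1) - ln_Gamma x = ln x"
    using assms Gamma_real_pos[OF assms]
    by (simp add: ln_Gamma_real_pos ln_mult del: Gamma_real_pos)
  with z have *: "Digamma z = ln x" by simp
  show "Digamma x \<le> ln x"
    using Digamma_real_mono[of x z] z assms * by simp
  show "ln x \<le> Digamma x + 1 / x"
    using Digamma_real_mono[of z "x + 1"] z assms * by (simp add: Digamma_plus1)
qed

text \<open>The increment 1 / x of \<open>Digamma\<close> over [x, x + 1] is a trigamma value at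
  some z > x, and trigamma is decreasing.\<close>

lemma Polygamma_1_real_ge_inverse:
  fixes x :: real
  assumes "x > 0"
  shows "Polygamma 1 x \<ge> 1 / x"
proof -
  have "\<exists>z. x < z \<and> z < x + 1 \<and> Digamma (x + 1) - Digamma x = (x + 1 - x) * Polygamma (Suc 0) z"
    using assms
    by (intro MVT2 has_field_derivative_Polygamma) (auto elim!: nonpos_Ints_cases)
  then obtain z where z: "x < z" "Digamma (x + 1) - Digamma x = Polygamma 1 z"
    by auto
  then show ?thesis
    using Polygamma_real_strict_antimono[of x z 1] assms by (simp add: Digamma_plus1)
qed

text \<open>The exponent h has derivative \<open>ln t - Digamma t\<close>, which lies between 0 and
  1 / t. Hence h is nondecreasing up to 1 and \<open>h - ln\<close> is nonincreasing beyond 1, and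
  both equal -1 at 1.\<close>

lemma Stirling_remainder_bound:
  fixes t :: real
  assumes "t > 0"
  shows "exp (t * ln t - t - ln_Gamma t) \<le> max 1 t"
proof -
  define h :: "real \<Rightarrow> real" where "h = (\<lambda>t. t * ln t - t - ln_Gamma t)"
  have h': "(h has_real_derivative (ln t - Digamma t)) (at t)" if "t > 0" for t
    unfolding h_def using that by (auto intro!: derivative_eq_intros)
  have h1: "h 1 = -1"
    by (simp add: h_def ln_Gamma_real_pos)
  show ?thesis
  proof (cases "t \<le> 1")
    case True
    have "h t \<le> h 1"
    proof (rule DERIV_nonneg_imp_nondecreasing[OF True])
      fix x :: real assume "t \<le> x" "x \<le> 1"
      then show "\<exists>y. (h has_real_derivative y) (at x) \<and> 0 \<le> y"
        using assms h'[of x] ln_bounds_Digamma_real(1)[of x]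
        by (intro exI[of _ "ln x - Digamma x"]) auto
    qed
    then have "h t \<le> 0" using h1 by simp
    then have "exp (h t) \<le> max 1 t" by (simp add: le_max_iff_disj)
    then show ?thesis by (simp only: h_def)
  next
    case False
    then have "1 \<le> t" by simp
    then have "h t - ln t \<le> h 1 - ln 1"
    proof (rule DERIV_nonpos_imp_nonincreasing)
      fix x :: real assume "1 \<le> x" "x \<le> t"
      then show "\<exists>y. ((\<lambda>t. h t - ln t) has_real_derivative y) (at x) \<and> y \<le> 0"
        using ln_bounds_Digamma_real(2)[of x]
        by (intro exI[of _ "ln x - Digamma x - 1 / x"])
           (auto intro!: derivative_eq_intros h')
    qed
    then have "h t \<le> ln t" using h1 by simp
    then have "exp (h t) \<le> t" using assms by (metis exp_le_cancel_iff exp_ln)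
    then show ?thesis by (simp add: h_def le_max_iff_disj)
  qed
qed

subsection \<open>The normalising constant\<close>

lemma set_integrable_powr_exp:
  fixes s c :: real
  assumes "s > 0" "c > 0"
  shows "set_integrable lborel {0<..} (\<lambda>t. t powr (s - 1) * exp (- c * t))"
proof -
  \<comment> \<open>The Gamma integral is available for complex exponents; taking norms gives the
    real integrand.\<close>
  have "(\<lambda>t. norm (complex_of_real t powr (complex_of_real s - 1) / of_real (exp (c * t))))
      absolutely_integrable_on {0<..}"
    using absolutely_integrable_Gamma_integral[of "of_real s" c] assms
    by (intro absolutely_integrable_norm[unfolded o_def]) auto
  also have "?this \<longleftrightarrow> (\<lambda>t. t powr (s - 1) * exp (- c * t)) absolutely_integrable_on {0<..}"
    by (intro set_integrable_cong refl)
       (simp add: norm_divide norm_powr_real_powr exp_minus field_simps)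
  finally show ?thesis
    \<comment> \<open>Absolute integrability refers to Lebesgue measure, the completion of
      \<open>lborel\<close>; for a Borel function the two notions agree.\<close>
    unfolding set_integrable_def by (subst (asm) integrable_completion) auto
qed

lemma set_integral_pos_real:
  fixes f :: "real \<Rightarrow> real"
  assumes int: "set_integrable lborel {0<..} f" and pos: "\<And>t. t > 0 \<Longrightarrow> f t > 0"
  shows "(LINT t:{0<..}|lborel. f t) > 0"
proof -
  let ?F = "\<lambda>t. indicator {0<..} t *\<^sub>R f t"
  have nn: "?F t \<ge> 0" for t using pos[of t] by (auto simp: indicator_def)
  \<comment> \<open>Otherwise (0, 1), where \<open>?F\<close> is positive, would be a null
    set.\<close>
  have "\<not> (AE t in lborel. ?F t = 0)"
  proof
    assume "AE t in lborel. ?F t = 0"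
    then have "AE t in lborel. t \<notin> {0<..<1::real}"
      by eventually_elim (use pos in \<open>fastforce simp: indicator_def\<close>)
    then have "{0<..<1::real} \<in> null_sets lborel"
      by (subst AE_iff_null_sets) auto
    then show False by (auto dest: null_setsD1)
  qed
  moreover have "integral\<^sup>L lborel ?F \<ge> 0" using nn by simp
  ultimately show ?thesis
    using integral_nonneg_eq_0_iff_AE[of lborel ?F] int nn
    by (auto simp: set_lebesgue_integral_def set_integrable_def less_le)
qed

text \<open>Each summand has the form y - 1 - ln y with y = \<open>x i / m\<close>. This makes the
  rate \<open>b0 + stat_T n x m\<close> positive.\<close>

lemma stat_T_nonneg:
  assumes "\<And>i. i \<in> {1..n} \<Longrightarrow> x i > 0" "m > 0"
  shows "stat_T n x m \<ge> 0"
proof -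
  have "stat_T n x m = (\<Sum>i=1..n. x i / m - ln (x i) + ln m - 1)"
    by (simp add: stat_T_def stat_S_def stat_R_def sum.distrib sum_subtractf sum_divide_distrib)
  also have "\<dots> \<ge> 0"
  proof (rule sum_nonneg)
    fix i assume "i \<in> {1..n}"
    then show "0 \<le> x i / m - ln (x i) + ln m - 1"
      using assms(1)[of i] assms(2) ln_le_minus_one[of "x i / m"] by (simp add: ln_div)
  qed
  finally show ?thesis .
qed

lemma full_cond_kernel_eq:
  assumes "\<And>i. i \<in> {1..n} \<Longrightarrow> x i > 0" "m > 0" "t > 0"
  shows "full_cond_kernel n x m a0 b0 t =
    exp (- stat_R n x) * (t powr (a0 - 1) * exp (- (b0 + stat_T n x m) * t)) *
    exp (t * ln t - t - ln_Gamma t) ^ n"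
proof -
  let ?e = "\<lambda>i. t * ln t - t * ln m - ln_Gamma t + (t - 1) * ln (x i) - t / m * x i"
  have "(\<Prod>i=1..n. (t / m) powr t / Gamma t * x i powr (t - 1) * exp (- (t / m) * x i)) =
      (\<Prod>i=1..n. exp (?e i))"
  proof (rule prod.cong[OF refl])
    fix i assume "i \<in> {1..n}"
    then have "x i > 0" by (rule assms(1))
    then have "(t / m) powr t = exp (t * ln t - t * ln m)"
      "x i powr (t - 1) = exp ((t - 1) * ln (x i))"
      using assms by (simp_all add: powr_def ln_div right_diff_distrib)
    then show "(t / m) powr t / Gamma t * x i powr (t - 1) * exp (- (t / m) * x i) = exp (?e i)"
      using assms(3) by (simp add: Gamma_real_pos_exp flip: exp_add exp_diff)
  qed
  also have "\<dots> = exp (\<Sum>i=1..n. ?e i)"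
    by (simp add: exp_sum)
  \<comment> \<open>The term -n in \<open>stat_T\<close> compensates for the n copies of -t moved
    into the Stirling remainder.\<close>
  also have "(\<Sum>i=1..n. ?e i) = real n * (t * ln t - t - ln_Gamma t) - stat_R n x - stat_T n x m * t"
    by (simp add: stat_T_def stat_S_def stat_R_def sum.distrib sum_subtractf
        flip: sum_distrib_left sum_divide_distrib) (simp add: algebra_simps)
  also have "exp \<dots> = exp (- stat_R n x) * exp (- stat_T n x m * t) *
      exp (t * ln t - t - ln_Gamma t) ^ n"
    by (simp flip: exp_of_nat_mult exp_add)
  finally have prod: "(\<Prod>i=1..n. (t / m) powr t / Gamma t * x i powr (t - 1) *
      exp (- (t / m) * x i)) = \<dots>" .
  have "exp (- (b0 + stat_T n x m) * t) = exp (- b0 * t) * exp (- stat_T n x m * t)"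
    by (simp add: algebra_simps flip: exp_add)
  then show ?thesis
    unfolding full_cond_kernel_def prod by (simp only: mult_ac)
qed

lemma full_cond_kernel_pos:
  assumes "\<And>i. i \<in> {1..n} \<Longrightarrow> x i > 0" "m > 0" "t > 0"
  shows "full_cond_kernel n x m a0 b0 t > 0"
  by (subst full_cond_kernel_eq) (use assms in auto)

lemma set_integrable_full_cond_kernel:
  assumes x: "\<And>i. i \<in> {1..n} \<Longrightarrow> x i > 0" and m: "m > 0" and a0: "a0 > 0" and b0: "b0 > 0"
  shows "set_integrable lborel {0<..} (full_cond_kernel n x m a0 b0)"
proof -
  define c where "c = b0 + stat_T n x m"
  have c: "c > 0"
    using stat_T_nonneg[of n x m, OF x m] b0 by (simp add: c_def)
  define K where "K = (\<lambda>t. exp (- stat_R n x) * (t powr (a0 - 1) * exp (- c * t)) *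
    exp (t * ln t - t - ln_Gamma t) ^ n)"
  \<comment> \<open>Since max(1, t)^n \<le> 1 + t^n, the kernel is dominated by a multiple of the
    sum of two Gamma kernels of rate c, with shapes a0 and a0 + n.\<close>
  let ?g = "\<lambda>t. exp (- stat_R n x) *
    (t powr (a0 - 1) * exp (- c * t) + t powr (a0 + real n - 1) * exp (- c * t))"
  have "set_integrable lborel {0<..} K"
  proof (rule set_integrable_bound)
    show "set_integrable lborel {0<..} ?g"
      using a0 c
      by (intro set_integrable_mult_right set_integral_add(1) set_integrable_powr_exp) auto
    have "continuous_on {0<..} K"
      unfolding K_def
      by (auto intro!: continuous_intros
          DERIV_continuous_on[OF has_field_derivative_at_within[OF has_field_derivative_ln_Gamma_real]])
    then show "set_borel_measurable lborel {0<..} K"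
      using set_measurable_continuous_on[of "{0<..}" K]
      by (simp add: set_borel_measurable_def)
    have "norm (K t) \<le> norm (?g t)" if t: "t > 0" for t
    proof -
      have "exp (t * ln t - t - ln_Gamma t) ^ n \<le> max 1 t ^ n"
        by (intro power_mono Stirling_remainder_bound t) simp
      also have "\<dots> \<le> 1 + t ^ n"
        using t by (cases "t \<le> 1") (auto simp: max_def)
      finally have "K t \<le> exp (- stat_R n x) * (t powr (a0 - 1) * exp (- c * t)) * (1 + t ^ n)"
        unfolding K_def by (intro mult_left_mono) auto
      also have "t powr (a0 + real n - 1) = t powr (a0 - 1) * t ^ n"
        using t by (simp add: powr_realpow[symmetric] powr_add[symmetric] algebra_simps)
      then have "exp (- stat_R n x) * (t powr (a0 - 1) * exp (- c * t)) * (1 + t ^ n) = ?g t"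
        by (simp add: algebra_simps)
      finally have "K t \<le> ?g t" .
      moreover have "K t \<ge> 0" by (simp add: K_def)
      ultimately show ?thesis by simp
    qed
    then show "AE t in lborel. t \<in> {0<..} \<longrightarrow> norm (K t) \<le> norm (?g t)"
      by simp
  qed
  also have "?this \<longleftrightarrow> ?thesis"
    using full_cond_kernel_eq[of n x m, OF x m]
    by (intro set_integrable_cong refl) (simp add: K_def c_def)
  finally show ?thesis .
qed

subsection \<open>The score\<close>

definition score :: "nat \<Rightarrow> (nat \<Rightarrow> real) \<Rightarrow> real \<Rightarrow> real \<Rightarrow> real \<Rightarrow> real \<Rightarrow> real" where
  "score n x m a0 b0 a = a0 / a - (b0 + stat_T n x m) + real n * (ln a - Digamma a)"

lemma deriv_ln_full_cond_density:
  assumes x: "\<And>i. i \<in> {1..n} \<Longrightarrow> x i > 0" and m: "m > 0" and a0: "a0 > 0" and b0: "b0 > 0"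
    and a: "a > 0"
  shows "deriv (\<lambda>t. ln (full_cond_density n x m a0 b0 t)) a + 1 / a = score n x m a0 b0 a"
proof -
  define Z where "Z = (LINT t:{0<..}|lborel. full_cond_kernel n x m a0 b0 t)"
  have Z: "Z > 0"
    unfolding Z_def
    by (intro set_integral_pos_real set_integrable_full_cond_kernel full_cond_kernel_pos assms)
  define L where "L = (\<lambda>t. (a0 - 1) * ln t - (b0 + stat_T n x m) * t +
    real n * (t * ln t - t - ln_Gamma t) - stat_R n x - ln Z)"
  have eq: "ln (full_cond_density n x m a0 b0 t) = L t" if t: "t > 0" for t
  proof -
    have "full_cond_kernel n x m a0 b0 t = exp (L t + ln Z)"
      using t full_cond_kernel_eq[of n x m t a0 b0, OF x m t]
      by (simp add: L_def powr_def algebra_simps flip: exp_add exp_of_nat_mult)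
    then have "full_cond_density n x m a0 b0 t = exp (L t)"
      using t Z by (simp add: full_cond_density_def exp_add flip: Z_def)
    then show ?thesis by simp
  qed
  have "(L has_real_derivative score n x m a0 b0 a - 1 / a) (at a)"
    unfolding L_def score_def using a
    by (auto intro!: derivative_eq_intros simp: field_simps)
  \<comment> \<open>The formula for the logarithm holds only on the positive axis, which is open, so
    it holds near a and the derivative carries over.\<close>
  moreover have "eventually (\<lambda>t. ln (full_cond_density n x m a0 b0 t) = L t) (nhds a)"
    using eventually_nhds_in_open[of "{0<..}" a] a by (auto elim!: eventually_mono simp: eq)
  ultimately have "((\<lambda>t. ln (full_cond_density n x m a0 b0 t)) has_real_derivative
      score n x m a0 b0 a - 1 / a) (at a)"
    by (subst DERIV_cong_ev[OF refl _ refl])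
  then show ?thesis by (simp add: DERIV_imp_deriv)
qed

lemma score_eq_0_iff_fixed_point:
  assumes "a0 > 0" "a > 0"
  shows "score n x m a0 b0 a = 0 \<longleftrightarrow> algorithm_fixed_point n x m a0 b0 a"
proof -
  let ?A = "update_A n a0 a" and ?B = "update_B n x m a0 b0 a"
  have aB: "a * ?B = ?A - a * score n x m a0 b0 a"
    using assms by (simp add: update_B_def score_def field_simps)
  \<comment> \<open>The trigamma bound gives \<open>?A\<close> \<ge> a0 > 0, so
    \<open>a * ?B = ?A\<close> forces \<open>?B\<close> to be nonzero, as a fixed point
    demands.\<close>
  have "a\<^sup>2 * Polygamma 1 a \<ge> a\<^sup>2 * (1 / a)"
    by (intro mult_left_mono Polygamma_1_real_ge_inverse assms) simp
  then have "a\<^sup>2 * Polygamma 1 a - a \<ge> 0"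
    using assms by (simp add: power2_eq_square)
  then have "a0 + real n * (a\<^sup>2 * Polygamma 1 a - a) > 0"
    using assms by (intro add_pos_nonneg mult_nonneg_nonneg) auto
  then have A: "?A > 0"
    by (simp add: update_A_def algebra_simps)
  show ?thesis
  proof
    assume "score n x m a0 b0 a = 0"
    then have "a * ?B = ?A" using aB by simp
    moreover from this A have "?B \<noteq> 0" by auto
    ultimately show "algorithm_fixed_point n x m a0 b0 a"
      using assms by (simp add: algorithm_fixed_point_def field_simps)
  next
    assume "algorithm_fixed_point n x m a0 b0 a"
    then have "a * ?B = ?A"
      by (auto simp: algorithm_fixed_point_def field_simps)
    then show "score n x m a0 b0 a = 0" using aB assms by simp
  qed
qed

lemma score_has_zero:
  assumes a0: "a0 > 0" and c: "b0 + stat_T n x m > 0"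
  shows "\<exists>a>0. score n x m a0 b0 a = 0"
proof -
  let ?c = "b0 + stat_T n x m"
  \<comment> \<open>The digamma bounds squeeze the score between a0 / a - c and (a0 + n) / a - c;
    \<open>?l\<close> and \<open>?u\<close> are the zeros of these two functions and coincide when n
    = 0.\<close>
  let ?l = "a0 / ?c" and ?u = "(a0 + real n) / ?c"
  have l: "?l > 0" using a0 c by simp
  have lu: "?l \<le> ?u" using c by (intro divide_right_mono) auto
  then have u: "?u > 0" using l by linarith
  have "score n x m a0 b0 ?l = real n * (ln ?l - Digamma ?l)"
    using a0 c by (simp add: score_def)
  also have "\<dots> \<ge> 0"
    using ln_bounds_Digamma_real(1)[OF l] by simp
  finally have 1: "score n x m a0 b0 ?l \<ge> 0" .
  have "real n * (ln ?u - Digamma ?u) \<le> real n * (1 / ?u)"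
    using ln_bounds_Digamma_real(2)[OF u] by (intro mult_left_mono) auto
  then have "score n x m a0 b0 ?u \<le> a0 / ?u - ?c + real n * (1 / ?u)"
    by (simp add: score_def)
  also have "\<dots> = (a0 + real n) / ?u - ?c"
    by (simp add: add_divide_distrib)
  also have "(a0 + real n) / ?u = ?c"
    using a0 c by simp
  finally have 2: "score n x m a0 b0 ?u \<le> 0" by simp
  have "continuous_on {?l..?u} (score n x m a0 b0)"
    unfolding score_def[abs_def] using l
    by (intro continuous_intros continuous_on_Polygamma) (auto elim!: nonpos_Ints_cases)
  with IVT2'[of "score n x m a0 b0" ?u 0 ?l] 1 2 lu l show ?thesis
    by (meson less_le_trans)
qed

theorem theoremS1p1:
  fixes n :: nat and x :: "nat \<Rightarrow> real" and m a0 b0 :: real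
  assumes "\<And>i. i \<in> {1..n} \<Longrightarrow> x i > 0"
    and "m > 0" and "a0 > 0" and "b0 > 0"
  shows "(\<forall>a>0. deriv (\<lambda>t. ln (full_cond_density n x m a0 b0 t)) a + 1 / a = 0
                 \<longleftrightarrow> algorithm_fixed_point n x m a0 b0 a) \<and>
         (\<exists>a>0. deriv (\<lambda>t. ln (full_cond_density n x m a0 b0 t)) a + 1 / a = 0)"
proof -
  have "b0 + stat_T n x m > 0"
    using stat_T_nonneg[of n x m, OF assms(1,2)] assms(4) by simp
  then show ?thesis
    using deriv_ln_full_cond_density[of n x m a0 b0, OF assms]
      score_eq_0_iff_fixed_point[OF assms(3)] score_has_zero[OF assms(3)]
    by metis
qed

end
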